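(* Let $G$ be a multigraph with sink $s_G$ and let $H$ be a multigraph with sink $s_H$. Let $V\subset V(H)$ be such that $V(H)\setminus V$ is a stable set and $s_H\notin V$. Let $f:G\rightarrow H$ be a surjective $V$-uniform homomorphism such that $f^{-1}(s_H)=\{s_G\}$. Then the induced mapping $\widetilde{f}:SP(H,s_H) \rightarrow SP(G,s_G)$, given by \[ \widetilde{f}({\bf c})_v= \begin{cases} {\bf c}_{f(v)} & \text{ if } f(v) \in V, \\ \deg(f)\cdot {\bf c}_{f(v)} & \text{ if } f(v) \notin V, \end{cases} \qquad v\in V(G)\setminus\{s_G\}, \] is an injective homomorphism of groups; that is, $SP(H, s_H) \triangleleft SP(G, s_G)$ (via $\widetilde f$, $SP(H,s_H)$ is a subgroup of $SP(G,s_G)$).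
   Context: All multigraphs are finite, connected and without loops, possibly with parallel edges, and have a distinguished vertex called the sink. $m_{x,y}$ is the number of edges with ends $x$ and $y$ (so $m_{x,x}=0$), and $d_G(u)$ is the degree of $u$ in $G$, i.e. the number of edges incident to $u$. A set of vertices is stable if no edge joins two of its elements. $G[U]$ is the subgraph of $G$ induced by $U\subseteq V(G)$. $V$-uniform homomorphism: for $V\subseteq V(H)$, a $V$-uniform homomorphism $f:G\to H$ is a mapping $f:V(G)\rightarrow V(H)$ such that, writing $S_x=f^{-1}(x)$, (1) for all $x\in V$ and $y\in V(H)$, $d_{G[\{u\}\cup S_y]}(u)=m_{x,y}$ for all $u\in S_x$; and (2) $f: V(G)\setminus f^{-1}(V)\to V(H)\setminus V$ is the identity isomorphism (these vertex sets, with the subgraphs they induce, are identified by $f$). The degree $\deg(f)$ is the cardinality of $S_x$ for some $x\in V$ (when $H[V]$ is connected, all the sets $S_x$ with $x\in V$ have the same cardinality). Sandpile group of a multigraph $G$ with sink $s$: let $\widetilde V=V(G)\setminus\{s\}$. A configuration is a vector ${\bf c}\in\mathbb{N}^{\widetilde V}$ (with $0\in\mathbb{N}$). A vertex $v\in\widetilde V$ is stable in ${\bf c}$ if ${\bf c}_v<d_G(v)$ and unstable otherwise; ${\bf c}$ is stable if every $v\in\widetilde V$ is stable. Toppling an unstable vertex $u$ decreases ${\bf c}_u$ by $d_G(u)$ and increases ${\bf c}_v$ by $m_{u,v}$ for every $v\in\widetilde V\setminus\{u\}$. By a sequence of topplings every configuration reaches a unique stable configuration, denoted $s({\bf c})$.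 A configuration ${\bf c}$ is recurrent if it is stable and there exists a non-zero configuration ${\bf r}$ such that $s({\bf c}+{\bf r})={\bf c}$. The sandpile group $SP(G,s)$ is the set of recurrent configurations with the binary operation ${\bf c}\oplus{\bf d}=s({\bf c}+{\bf d})$.
   Formalization: All S_x with x in V are assumed equal in size, so that deg(f) is well defined; recurrence asks r to be non-zero on every component of G minus the sink, as otherwise SP(G,s) need not be a group; for the literal definition an injective operation-preserving map is shown. *)

theory Defs
  imports "HOL-Algebra.Group"
begin

section \<open>Multigraphs with a sink\<close>

record ('v, 'e) mgraph =
  verts :: "'v set"
  edges :: "'e set"
  ends :: "'e \<Rightarrow> 'v set"

definition edge_count :: "('v, 'e) mgraph \<Rightarrow> 'v \<Rightarrow> 'v \<Rightarrow> nat" where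
  "edge_count G x y = card {e \<in> edges G. ends G e = {x, y}}"

definition degree :: "('v, 'e) mgraph \<Rightarrow> 'v \<Rightarrow> nat" where
  "degree G u = card {e \<in> edges G. u \<in> ends G e}"

definition induced :: "('v, 'e) mgraph \<Rightarrow> 'v set \<Rightarrow> ('v, 'e) mgraph" where
  "induced G U = \<lparr>verts = verts G \<inter> U, edges = {e \<in> edges G. ends G e \<subseteq> U}, ends = ends G\<rparr>"

definition adjacent :: "('v, 'e) mgraph \<Rightarrow> 'v \<Rightarrow> 'v \<Rightarrow> bool" where
  "adjacent G x y \<longleftrightarrow> (\<exists>e \<in> edges G. ends G e = {x, y})"

definition connected_mgraph :: "('v, 'e) mgraph \<Rightarrow> bool" where
  "connected_mgraph G \<longleftrightarrow> (\<forall>x \<in> verts G. \<forall>y \<in> verts G. (adjacent G)\<^sup>*\<^sup>* x y)"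

definition stable_set :: "('v, 'e) mgraph \<Rightarrow> 'v set \<Rightarrow> bool" where
  "stable_set G U \<longleftrightarrow> (\<forall>x \<in> U. \<forall>y \<in> U. \<not> adjacent G x y)"

locale multigraph =
  fixes G :: "('v, 'e) mgraph" and s :: 'v
  assumes finite_verts: "finite (verts G)"
    and finite_edges: "finite (edges G)"
    and ends_subset: "e \<in> edges G \<Longrightarrow> ends G e \<subseteq> verts G"
    and loopless: "e \<in> edges G \<Longrightarrow> card (ends G e) = 2"
    and connected: "connected_mgraph G"
    and sink: "s \<in> verts G"


section \<open>Uniform homomorphisms\<close>

definition fiber :: "('v, 'e) mgraph \<Rightarrow> ('v \<Rightarrow> 'w) \<Rightarrow> 'w \<Rightarrow> 'v set" where
  "fiber G f x = {u \<in> verts G. f u = x}"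

text \<open>The vertex types of the two multigraphs may differ, so the ``identity isomorphism'' outside
  the preimage of \<open>V\<close> is the statement that \<open>f\<close> is an isomorphism between the induced subgraphs,
  which is what identifies them.\<close>

definition uniform_hom ::
  "('v, 'e) mgraph \<Rightarrow> ('w, 'd) mgraph \<Rightarrow> 'w set \<Rightarrow> ('v \<Rightarrow> 'w) \<Rightarrow> bool" where
  "uniform_hom G H V f \<longleftrightarrow>
     f \<in> verts G \<rightarrow> verts H \<and>
     (\<forall>x \<in> V. \<forall>y \<in> verts H. \<forall>u \<in> fiber G f x.
        degree (induced G ({u} \<union> fiber G f y)) u = edge_count H x y) \<and>
     bij_betw f {u \<in> verts G. f u \<notin> V} (verts H - V) \<and>
     (\<forall>u \<in> verts G. \<forall>v \<in> verts G. f u \<notin> V \<longrightarrow> f v \<notin> V \<longrightarrow>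
        edge_count G u v = edge_count H (f u) (f v))"

text \<open>The degree is the cardinality of any fibre over \<open>V\<close>; it is meaningful when these fibres all
  have the same cardinality, which is automatic when \<open>V\<close> induces a connected subgraph
  (\<open>uniform_hom_degree_well_defined\<close> below) but can fail otherwise.\<close>

definition degree_well_defined :: "('v, 'e) mgraph \<Rightarrow> 'w set \<Rightarrow> ('v \<Rightarrow> 'w) \<Rightarrow> bool" where
  "degree_well_defined G V f \<longleftrightarrow> (\<forall>x \<in> V. \<forall>y \<in> V. card (fiber G f x) = card (fiber G f y))"

definition hom_degree :: "('v, 'e) mgraph \<Rightarrow> 'w set \<Rightarrow> ('v \<Rightarrow> 'w) \<Rightarrow> nat" where
  "hom_degree G V f = card (fiber G f (SOME x. x \<in> V))"


section \<open>Sandpile groups\<close>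

text \<open>A vector indexed by the non-sink vertices is a function on all of \<open>'v\<close> that vanishes
  elsewhere, so that equality of functions is equality of vectors.\<close>

definition nonsink :: "('v, 'e) mgraph \<Rightarrow> 'v \<Rightarrow> 'v set" where
  "nonsink G s = verts G - {s}"

definition configs :: "('v, 'e) mgraph \<Rightarrow> 'v \<Rightarrow> ('v \<Rightarrow> nat) set" where
  "configs G s = {c. \<forall>v. v \<notin> nonsink G s \<longrightarrow> c v = 0}"

definition stable_config :: "('v, 'e) mgraph \<Rightarrow> 'v \<Rightarrow> ('v \<Rightarrow> nat) \<Rightarrow> bool" where
  "stable_config G s c \<longleftrightarrow> c \<in> configs G s \<and> (\<forall>v \<in> nonsink G s. c v < degree G v)"

definition topples :: "('v, 'e) mgraph \<Rightarrow> 'v \<Rightarrow> ('v \<Rightarrow> nat) \<Rightarrow> ('v \<Rightarrow> nat) \<Rightarrow> bool" where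
  "topples G s c d \<longleftrightarrow> (\<exists>u \<in> nonsink G s. degree G u \<le> c u \<and>
     d = (\<lambda>v. if v = u then c u - degree G u
              else if v \<in> nonsink G s then c v + edge_count G u v
              else c v))"

definition stabilize :: "('v, 'e) mgraph \<Rightarrow> 'v \<Rightarrow> ('v \<Rightarrow> nat) \<Rightarrow> ('v \<Rightarrow> nat)" where
  "stabilize G s c = (THE d. (topples G s)\<^sup>*\<^sup>* c d \<and> stable_config G s d)"

definition config_add :: "('v \<Rightarrow> nat) \<Rightarrow> ('v \<Rightarrow> nat) \<Rightarrow> ('v \<Rightarrow> nat)" where
  "config_add c d = (\<lambda>v. c v + d v)"

text \<open>Recurrence in its common short form: stable and reproduced by adding some non-zero
  configuration. If the sink is a cut vertex, this does not define a group: take two copies of the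
  path \<open>s - a - b\<close> glued at the sink \<open>s\<close>. With \<open>(i, j)\<close> the numbers of grains on the two copies
  of \<open>a\<close>, and none on those of \<open>b\<close>, the configurations satisfying it are \<open>(1, 1)\<close>, \<open>(1, 0)\<close> and
  \<open>(0, 1)\<close>, each of which is idempotent.\<close>

definition recurrent_short :: "('v, 'e) mgraph \<Rightarrow> 'v \<Rightarrow> ('v \<Rightarrow> nat) \<Rightarrow> bool" where
  "recurrent_short G s c \<longleftrightarrow> stable_config G s c \<and>
     (\<exists>r \<in> configs G s. r \<noteq> (\<lambda>_. 0) \<and> stabilize G s (config_add c r) = c)"

text \<open>Hence the added configuration is required to be non-zero on every connected component of the
  multigraph without its sink. When there is exactly one component this is the short form, see
  \<open>recurrent_iff_recurrent_short\<close>.\<close>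

definition recurrent :: "('v, 'e) mgraph \<Rightarrow> 'v \<Rightarrow> ('v \<Rightarrow> nat) \<Rightarrow> bool" where
  "recurrent G s c \<longleftrightarrow> stable_config G s c \<and>
     (\<exists>r \<in> configs G s.
        (\<forall>v \<in> nonsink G s. \<exists>w \<in> nonsink G s.
           (adjacent (induced G (nonsink G s)))\<^sup>*\<^sup>* v w \<and> r w \<noteq> 0) \<and>
        stabilize G s (config_add c r) = c)"

text \<open>The neutral element has no closed formula; the record field is filled by its
  characteristic property.\<close>

definition sandpile_on ::
  "('v \<Rightarrow> nat) set \<Rightarrow> ('v, 'e) mgraph \<Rightarrow> 'v \<Rightarrow> ('v \<Rightarrow> nat) monoid" where
  "sandpile_on R G s =
     \<lparr>carrier = R,
      mult = (\<lambda>c d. stabilize G s (config_add c d)),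
      one = (THE e. e \<in> R \<and> (\<forall>c \<in> R. stabilize G s (config_add e c) = c))\<rparr>"

definition sandpile_group :: "('v, 'e) mgraph \<Rightarrow> 'v \<Rightarrow> ('v \<Rightarrow> nat) monoid" where
  "sandpile_group G s = sandpile_on {c. recurrent G s c} G s"

definition sandpile_short :: "('v, 'e) mgraph \<Rightarrow> 'v \<Rightarrow> ('v \<Rightarrow> nat) monoid" where
  "sandpile_short G s = sandpile_on {c. recurrent_short G s c} G s"

definition induced_map ::
  "('v, 'e) mgraph \<Rightarrow> 'v \<Rightarrow> 'w set \<Rightarrow> ('v \<Rightarrow> 'w) \<Rightarrow> ('w \<Rightarrow> nat) \<Rightarrow> ('v \<Rightarrow> nat)" where
  "induced_map G s V f c =
     (\<lambda>v. if v \<in> nonsink G s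
          then (if f v \<in> V then c (f v) else hom_degree G V f * c (f v))
          else 0)"


section \<open>Consistency of the definitions\<close>

lemma recurrent_iff_recurrent_short:
  assumes conn: "connected_mgraph (induced G (nonsink G s))" and ne: "nonsink G s \<noteq> {}"
  shows "recurrent G s c \<longleftrightarrow> recurrent_short G s c"
proof -
  have sub: "verts (induced G (nonsink G s)) = nonsink G s"
    by (auto simp: induced_def nonsink_def)
  have "(\<forall>v \<in> nonsink G s. \<exists>w \<in> nonsink G s.
           (adjacent (induced G (nonsink G s)))\<^sup>*\<^sup>* v w \<and> r w \<noteq> 0) \<longleftrightarrow> r \<noteq> (\<lambda>_. 0)"
    (is "?L \<longleftrightarrow> ?R") if r: "r \<in> configs G s" for r
  proof
    assume ?L
    then show ?R using ne by auto
  next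
    assume ?R
    then obtain w where w: "r w \<noteq> 0" by auto
    then have "w \<in> nonsink G s" using r by (auto simp: configs_def)
    then show ?L using w conn unfolding connected_mgraph_def sub by blast
  qed
  then show ?thesis unfolding recurrent_def recurrent_short_def by blast
qed

corollary sandpile_group_eq_sandpile_short:
  assumes "connected_mgraph (induced G (nonsink G s))" "nonsink G s \<noteq> {}"
  shows "sandpile_group G s = sandpile_short G s"
proof -
  have "recurrent G s = recurrent_short G s"
    by (rule ext) (rule recurrent_iff_recurrent_short[OF assms])
  then show ?thesis by (simp add: sandpile_group_def sandpile_short_def)
qed

lemma card_edges_between_fibers:
  assumes G: "multigraph G s" and f: "uniform_hom G H V f"
    and x: "x \<in> V" and y: "y \<in> verts H" and xy: "x \<noteq> y"
  shows "card {e \<in> edges G. \<exists>u \<in> fiber G f x. \<exists>v \<in> fiber G f y. ends G e = {u, v}}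
         = card (fiber G f x) * edge_count H x y"
proof -
  interpret multigraph G s by fact
  define D where "D u = {e \<in> edges G. ends G e \<subseteq> {u} \<union> fiber G f y \<and> u \<in> ends G e}" for u
  have D: "card (D u) = edge_count H x y" if "u \<in> fiber G f x" for u
  proof -
    have "card (D u) = degree (induced G ({u} \<union> fiber G f y)) u"
      by (simp add: D_def degree_def induced_def conj_assoc)
    then show ?thesis using f x y that unfolding uniform_hom_def by simp
  qed
  have Dends: "\<exists>v \<in> fiber G f y. ends G e = {u, v}" if "e \<in> D u" for e u
  proof -
    have e: "e \<in> edges G" "ends G e \<subseteq> {u} \<union> fiber G f y" "u \<in> ends G e"
      using that by (auto simp: D_def)
    obtain a b where ab: "ends G e = {a, b}" "a \<noteq> b"
      using loopless[OF e(1)] by (auto simp: card_2_iff)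
    then show ?thesis using e by auto
  qed
  have eq: "{e \<in> edges G. \<exists>u \<in> fiber G f x. \<exists>v \<in> fiber G f y. ends G e = {u, v}}
      = (\<Union>u \<in> fiber G f x. D u)"
  proof (intro equalityI subsetI)
    fix e assume "e \<in> {e \<in> edges G. \<exists>u \<in> fiber G f x. \<exists>v \<in> fiber G f y. ends G e = {u, v}}"
    then show "e \<in> (\<Union>u \<in> fiber G f x. D u)" by (auto simp: D_def)
  next
    fix e assume "e \<in> (\<Union>u \<in> fiber G f x. D u)"
    then obtain u where u: "u \<in> fiber G f x" "e \<in> D u" by blast
    moreover have "e \<in> edges G" using u(2) by (simp add: D_def)
    ultimately show "e \<in> {e \<in> edges G. \<exists>u \<in> fiber G f x. \<exists>v \<in> fiber G f y. ends G e = {u, v}}"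
      using Dends[OF u(2)] by blast
  qed
  have fin: "finite (fiber G f x)" using finite_verts by (simp add: fiber_def)
  have disj: "D u \<inter> D u' = {}"
    if "u \<in> fiber G f x" "u' \<in> fiber G f x" "u \<noteq> u'" for u u'
    using that xy by (auto simp: D_def fiber_def)
  have "card (\<Union>u \<in> fiber G f x. D u) = (\<Sum>u \<in> fiber G f x. card (D u))"
    by (rule card_UN_disjoint) (use fin disj finite_edges in \<open>auto simp: D_def\<close>)
  then show ?thesis using D by (simp add: eq)
qed

lemma uniform_hom_degree_well_defined:
  fixes G :: "('v, 'e) mgraph"
  assumes G: "multigraph G s" and H: "multigraph H t" and f: "uniform_hom G H V f"
    and V: "V \<subseteq> verts H" and conn: "connected_mgraph (induced H V)"
  shows "degree_well_defined G V f"
proof -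
  have along_edge: "y \<in> V \<and> card (fiber G f x) = card (fiber G f y)"
    if x: "x \<in> V" and a: "adjacent (induced H V) x y" for x y
  proof -
    interpret H: multigraph H t by fact
    obtain e where e: "e \<in> edges H" "ends H e = {x, y}" "{x, y} \<subseteq> V"
      using a by (auto simp: adjacent_def induced_def)
    have xy: "x \<noteq> y" using H.loopless[OF e(1)] e(2) by auto
    have pos: "edge_count H x y > 0"
      unfolding edge_count_def using e H.finite_edges by (auto simp: card_gt_0_iff)
    have sym: "edge_count H y x = edge_count H x y"
      by (simp add: edge_count_def insert_commute)
    have mem: "x \<in> V" "y \<in> V" "x \<in> verts H" "y \<in> verts H" using e(3) V by auto
    have flip: "{e \<in> edges G. \<exists>u \<in> fiber G f x. \<exists>v \<in> fiber G f y. ends G e = {u, v}}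
        = {e \<in> edges G. \<exists>u \<in> fiber G f y. \<exists>v \<in> fiber G f x. ends G e = {u, v}}"
    proof (intro Collect_cong conj_cong refl)
      fix e
      have "{u, v} = {v, u}" for u v :: 'v by blast
      then show "(\<exists>u \<in> fiber G f x. \<exists>v \<in> fiber G f y. ends G e = {u, v})
          \<longleftrightarrow> (\<exists>u \<in> fiber G f y. \<exists>v \<in> fiber G f x. ends G e = {u, v})"
        by metis
    qed
    have "card (fiber G f x) * edge_count H x y = card (fiber G f y) * edge_count H y x"
      by (rule trans[OF card_edges_between_fibers[OF G f mem(1,4) xy, symmetric]],
          rule trans[OF arg_cong[OF flip, of card]],
          rule card_edges_between_fibers[OF G f mem(2,3) xy[symmetric]])
    then show ?thesis using pos sym e(3) by simp
  qed
  have "y \<in> V \<and> card (fiber G f x) = card (fiber G f y)"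
    if "(adjacent (induced H V))\<^sup>*\<^sup>* x y" "x \<in> V" for x y
    using that
  proof (induction rule: rtranclp_induct)
    case base
    then show ?case by blast
  next
    case (step z w)
    then show ?case using along_edge[of z w] by metis
  qed
  moreover have "verts (induced H V) = V" using V by (auto simp: induced_def)
  ultimately show ?thesis
    using conn unfolding degree_well_defined_def connected_mgraph_def by metis
qed

end

theory Submission
  imports Defs "HOL-Library.Confluence"
begin

text \<open>The fibre over \<open>x\<close> is an independent set of vertices, each of degree \<open>deg x\<close> if \<open>x \<in> V\<close> and
  \<open>deg f \<cdot> deg x\<close> otherwise. Hence toppling \<open>x\<close> in \<open>H\<close> is mirrored by toppling every vertex of its
  fibre once in \<open>G\<close>, and stability is preserved as well, so the induced map, which is additive,
  commutes with stabilization. Edges lift along \<open>f\<close>, so an added configuration that is non-zero on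
  every component of \<open>H\<close> without its sink is mapped to one with the same property for \<open>G\<close>, and
  recurrence is preserved.\<close>


section \<open>Stabilization\<close>

lemma edge_count_commute: "edge_count G u v = edge_count G v u"
  by (simp add: edge_count_def insert_commute)

text \<open>Toppling as a total operator, so that topplings at different vertices compose as
  functions. The subtraction truncates, so legality \<open>degree G u \<le> c u\<close> is required
  separately wherever \<open>fire\<close> stands for a toppling.\<close>

definition fire :: "('v, 'e) mgraph \<Rightarrow> 'v \<Rightarrow> 'v \<Rightarrow> ('v \<Rightarrow> nat) \<Rightarrow> 'v \<Rightarrow> nat" where
  "fire G s u c = (\<lambda>v. if v = u then c u - degree G u
     else if v \<in> nonsink G s then c v + edge_count G u v else c v)"

lemma topples_iff_fire:
  "topples G s c d \<longleftrightarrow> (\<exists>u \<in> nonsink G s. degree G u \<le> c u \<and> d = fire G s u c)"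
  by (simp add: topples_def fire_def)

lemma topples_fire:
  "u \<in> nonsink G s \<Longrightarrow> degree G u \<le> c u \<Longrightarrow> topples G s c (fire G s u c)"
  unfolding topples_iff_fire by blast

text \<open>Legality at \<open>c\<close> lets the truncated subtraction commute with adding
  \<open>r\<close>.\<close>

lemma fire_config_add:
  "degree G u \<le> c u \<Longrightarrow> fire G s u (config_add c r) = config_add (fire G s u c) r"
  by (auto simp: fire_def config_add_def)

lemma config_add_configs: "c \<in> configs G s \<Longrightarrow> d \<in> configs G s \<Longrightarrow> config_add c d \<in> configs G s"
  by (simp add: configs_def config_add_def)

lemma config_add_commute: "config_add c d = config_add d c"
  by (simp add: config_add_def add.commute)

lemma config_add_assoc: "config_add (config_add c d) e = config_add c (config_add d e)"
  by (simp add: config_add_def add.assoc)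

lemma stable_config_configs: "stable_config G s c \<Longrightarrow> c \<in> configs G s"
  by (simp add: stable_config_def)

lemma topples_config_add:
  "topples G s c d \<Longrightarrow> topples G s (config_add c r) (config_add d r)"
  using fire_config_add[of G _ c s r] unfolding topples_iff_fire
  by (metis config_add_def trans_le_add1)

lemma rtranclp_topples_config_add_left:
  "(topples G s)\<^sup>*\<^sup>* c d \<Longrightarrow> (topples G s)\<^sup>*\<^sup>* (config_add c r) (config_add d r)"
  by (induction rule: rtranclp_induct) (auto intro: topples_config_add rtranclp.rtrancl_into_rtrancl)

text \<open>Run the first sequence with \<open>c'\<close> as a spectator, then the second with
  \<open>d\<close> as a spectator.\<close>

lemma rtranclp_topples_config_add:
  assumes "(topples G s)\<^sup>*\<^sup>* c d" "(topples G s)\<^sup>*\<^sup>* c' d'"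
  shows "(topples G s)\<^sup>*\<^sup>* (config_add c c') (config_add d d')"
  using rtranclp_topples_config_add_left[OF assms(1), of c']
    rtranclp_topples_config_add_left[OF assms(2), of d]
  by (simp add: config_add_commute[of _ d])

lemma topples_configs: "topples G s c d \<Longrightarrow> c \<in> configs G s \<Longrightarrow> d \<in> configs G s"
  by (auto simp: topples_def configs_def)

lemma rtranclp_topples_configs:
  "(topples G s)\<^sup>*\<^sup>* c d \<Longrightarrow> c \<in> configs G s \<Longrightarrow> d \<in> configs G s"
  by (induction rule: rtranclp_induct) (auto intro: topples_configs)

section \<open>Confluence and uniqueness of the stabilization\<close>

lemma fire_commute:
  assumes "u \<in> nonsink G s" "v \<in> nonsink G s" "u \<noteq> v" "degree G u \<le> c u" "degree G v \<le> c v"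
  shows "fire G s u (fire G s v c) = fire G s v (fire G s u c)"
  using assms by (auto simp: fire_def fun_eq_iff)

text \<open>Toppling one vertex never lowers another, so two legal topplings at distinct vertices
  stay legal one after the other and commute by \<open>fire_commute\<close>. Every fork thus closes
  with one step on each side.\<close>

lemma confluentp_topples: "confluentp (topples G s)"
proof (rule strong_confluentp_imp_confluentp, rule strong_confluentpI)
  fix c d e assume "topples G s c d" "topples G s c e"
  then obtain u v where u: "u \<in> nonsink G s" "degree G u \<le> c u" "d = fire G s u c"
    and v: "v \<in> nonsink G s" "degree G v \<le> c v" "e = fire G s v c"
    unfolding topples_iff_fire by blast
  show "\<exists>w. (topples G s)\<^sup>*\<^sup>* d w \<and> (topples G s)\<^sup>=\<^sup>= e w"
  proof (cases "u = v")
    case False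
    have "degree G v \<le> d v" "degree G u \<le> e u"
      using u v False by (auto simp: fire_def)
    then have "topples G s d (fire G s v d)" "topples G s e (fire G s u e)"
      using u(1) v(1) by (blast intro: topples_fire)+
    moreover have "fire G s v d = fire G s u e"
      using fire_commute[of u G s v c] u v False by simp
    ultimately show ?thesis by (metis r_into_rtranclp sup2I1)
  qed (use u v in blast)
qed

lemma rtranclp_topples_stable:
  assumes "(topples G s)\<^sup>*\<^sup>* c d" "stable_config G s c"
  shows "d = c"
  using assms by (cases rule: converse_rtranclpE)
    (force simp: stable_config_def topples_def)+

text \<open>By confluence, two stable configurations reachable from \<open>c\<close> have a common
  successor, and a stable one reaches only itself. Exhibiting one toppling sequence therefore
  determines the definite description.\<close>

lemma stabilize_eq:
  assumes "(topples G s)\<^sup>*\<^sup>* c d" "stable_config G s d"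
  shows "stabilize G s c = d"
  unfolding stabilize_def
proof (rule the_equality)
  fix e assume "(topples G s)\<^sup>*\<^sup>* c e \<and> stable_config G s e"
  then show "e = d"
    using confluentpD[OF confluentp_topples assms(1), of e] rtranclp_topples_stable assms(2)
    by metis
qed (use assms in blast)

lemma stabilize_stable: "stable_config G s c \<Longrightarrow> stabilize G s c = c"
  by (simp add: stabilize_eq)

section \<open>Compound topplings\<close>

text \<open>No vertex of \<open>A\<close> gains grains while others of \<open>A\<close> topple, so
  each stays legal, and every other non-sink vertex collects the sum over its edges to
  \<open>A\<close>.\<close>

lemma topple_independent_set:
  assumes "finite A" "A \<subseteq> nonsink G s" "\<forall>u \<in> A. \<forall>v \<in> A. edge_count G u v = 0"
    and "\<forall>u \<in> A. degree G u \<le> c u"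
  shows "(topples G s)\<^sup>*\<^sup>* c (\<lambda>v. if v \<in> A then c v - degree G v
     else if v \<in> nonsink G s then c v + (\<Sum>u \<in> A. edge_count G u v) else c v)"
  using assms
proof (induction A rule: finite_induct)
  case (insert a A)
  define d where "d = (\<lambda>v. if v \<in> A then c v - degree G v
     else if v \<in> nonsink G s then c v + (\<Sum>u \<in> A. edge_count G u v) else c v)"
  define e where "e = (\<lambda>v. if v \<in> insert a A then c v - degree G v
     else if v \<in> nonsink G s then c v + (\<Sum>u \<in> insert a A. edge_count G u v) else c v)"
  have cd: "(topples G s)\<^sup>*\<^sup>* c d" unfolding d_def using insert by blast
  \<comment> \<open>\<open>a\<close> has received nothing from \<open>A\<close>, so its legality in
    \<open>c\<close> carries over to \<open>d\<close>.\<close>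
  have da: "d a = c a" unfolding d_def using insert by simp
  have "fire G s a d v = e v" for v
    using insert da unfolding fire_def by (auto simp: d_def e_def)
  then have "fire G s a d = e" ..
  then have "topples G s d e" using topples_fire[of a G s d] insert.prems da by simp
  with cd have "(topples G s)\<^sup>*\<^sup>* c e" by simp
  then show ?case unfolding e_def .
qed (simp cong: if_cong)

text \<open>Serves to push grains from \<open>v\<close> to a neighbour; the height left at
  \<open>v\<close> itself stays unspecified.\<close>

lemma topple_repeatedly:
  assumes "v \<in> nonsink G s" "m * degree G v \<le> c v"
  shows "\<exists>d. (topples G s)\<^sup>*\<^sup>* c d \<and>
    (\<forall>w \<in> nonsink G s. w \<noteq> v \<longrightarrow> d w = c w + m * edge_count G v w)"
  using assms
proof (induction m arbitrary: c)
  case (Suc m)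
  have "m * degree G v \<le> fire G s v c v" using Suc.prems by (simp add: fire_def)
  then obtain d where d: "(topples G s)\<^sup>*\<^sup>* (fire G s v c) d"
    "\<forall>w \<in> nonsink G s. w \<noteq> v \<longrightarrow> d w = fire G s v c w + m * edge_count G v w"
    using Suc.IH Suc.prems by blast
  have "topples G s c (fire G s v c)" using Suc.prems by (intro topples_fire) auto
  then have "(topples G s)\<^sup>*\<^sup>* c d" using d(1) by (rule converse_rtranclp_into_rtranclp)
  moreover have "\<forall>w \<in> nonsink G s. w \<noteq> v \<longrightarrow> d w = c w + Suc m * edge_count G v w"
    using d(2) by (simp add: fire_def)
  ultimately show ?case by blast
qed auto

section \<open>Edge counts, degrees and termination of toppling\<close>

context multigraph
begin

lemma edge_count_refl [simp]: "edge_count G u u = 0"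
proof -
  have "{e \<in> edges G. ends G e = {u, u}} = {}" using loopless by fastforce
  then show ?thesis unfolding edge_count_def by (simp only: card.empty)
qed

lemma edge_count_pos_iff: "edge_count G u v > 0 \<longleftrightarrow> adjacent G u v"
  using finite_edges by (auto simp: edge_count_def adjacent_def card_gt_0_iff)

lemma edge_count_eq_0: "\<not> adjacent G u v \<Longrightarrow> edge_count G u v = 0"
  using edge_count_pos_iff by blast

lemma adjacent_verts: "adjacent G u v \<Longrightarrow> u \<in> verts G \<and> v \<in> verts G"
  using ends_subset by (fastforce simp: adjacent_def)

lemma adjacent_commute: "adjacent G u v \<longleftrightarrow> adjacent G v u"
  by (simp add: adjacent_def insert_commute)

lemma finite_nonsink: "finite (nonsink G s)"
  using finite_verts by (simp add: nonsink_def)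

text \<open>Edges at \<open>u\<close> are split by their other end, which lies in \<open>F\<close>
  by looplessness; if \<open>u\<close> is in \<open>F\<close>, its own class is empty. This turns
  the degree condition of \<open>uniform_hom\<close> into a sum of edge counts.\<close>

lemma degree_induced:
  assumes "finite F"
  shows "degree (induced G ({u} \<union> F)) u = (\<Sum>v \<in> F. edge_count G u v)"
proof -
  have "{e \<in> edges (induced G ({u} \<union> F)). u \<in> ends (induced G ({u} \<union> F)) e}
      = (\<Union>v \<in> F. {e \<in> edges G. ends G e = {u, v}})" (is "?L = ?R")
  proof (intro equalityI subsetI)
    fix e assume "e \<in> ?L"
    then have e: "e \<in> edges G" "ends G e \<subseteq> {u} \<union> F" "u \<in> ends G e" by (auto simp: induced_def)
    obtain a b where "ends G e = {a, b}" "a \<noteq> b"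
      using loopless[OF e(1)] by (auto simp: card_2_iff)
    then show "e \<in> ?R" using e by auto
  qed (auto simp: induced_def)
  moreover have "card ?R = (\<Sum>v \<in> F. edge_count G u v)"
    unfolding edge_count_def
    by (rule card_UN_disjoint) (use assms finite_edges in \<open>auto simp: doubleton_eq_iff\<close>)
  ultimately show ?thesis by (simp add: degree_def)
qed

lemma degree_eq_sum:
  assumes "u \<in> verts G"
  shows "degree G u = (\<Sum>v \<in> verts G. edge_count G u v)"
proof -
  have "degree G u = degree (induced G ({u} \<union> verts G)) u"
    using assms ends_subset unfolding degree_def induced_def
    by (intro arg_cong[of _ _ card]) (auto simp: insert_absorb)
  then show ?thesis using degree_induced[OF finite_verts] by simp
qed

lemma nonsink_adjacent:
  assumes "u \<in> nonsink G s"
  shows "\<exists>v. adjacent G u v"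
  using assms connected sink
  by (metis DiffE connected_mgraph_def converse_rtranclpE insertI1 nonsink_def)

lemma degree_pos:
  assumes "u \<in> nonsink G s"
  shows "degree G u > 0"
proof -
  obtain v where v: "adjacent G u v" using nonsink_adjacent assms by blast
  have "edge_count G u v \<le> degree G u"
    unfolding degree_eq_sum[OF conjunct1[OF adjacent_verts[OF v]]]
    by (rule member_le_sum) (use adjacent_verts[OF v] finite_verts in auto)
  then show ?thesis using v edge_count_pos_iff[of u v] by linarith
qed

text \<open>With \<open>h = B\<^sup>N\<^sup>-\<^sup>d\<close> at distance \<open>d\<close> from the sink and \<open>B\<close> above all degrees, the neighbour
  of a vertex closest to the sink already contributes more to \<open>\<Sum> m h\<close> than its degree times \<open>h\<close>.\<close>

lemma ex_subharmonic:
  "\<exists>h. (\<forall>v \<in> verts G. h v \<le> h s) \<and>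
    (\<forall>u \<in> nonsink G s. degree G u * h u < (\<Sum>v \<in> verts G. edge_count G u v * (h v :: nat)))"
proof -
  define B where "B = Suc (Max (degree G ` verts G))"
  have B: "degree G u < B" if "u \<in> verts G" for u
    unfolding B_def using that finite_verts by (simp add: less_Suc_eq_le)
  have "B > 0" by (simp add: B_def)
  define dist where "dist v = (LEAST n. (adjacent G ^^ n) s v)" for v
  have dist: "(adjacent G ^^ dist v) s v" if v: "v \<in> verts G" for v
  proof -
    have "(adjacent G)\<^sup>*\<^sup>* s v" using connected sink v by (auto simp: connected_mgraph_def)
    then show ?thesis unfolding dist_def rtranclp_power by (metis LeastI)
  qed
  have dist_s: "dist s = 0" unfolding dist_def by (rule Least_eq_0) simp
  define N where "N = Max (dist ` verts G)"
  have N: "dist v \<le> N" if "v \<in> verts G" for v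
    unfolding N_def using that finite_verts by simp
  define h where "h v = B ^ (N - dist v)" for v
  have "h v \<le> h s" for v
    unfolding h_def dist_s using \<open>B > 0\<close> by (intro power_increasing) auto
  moreover have "degree G u * h u < (\<Sum>v \<in> verts G. edge_count G u v * h v)"
    if "u \<in> nonsink G s" for u
  proof -
    have u: "u \<in> verts G" "u \<noteq> s" using that by (auto simp: nonsink_def)
    then obtain n where n: "dist u = Suc n"
      using dist[OF u(1)] by (cases "dist u") auto
    obtain v where v: "(adjacent G ^^ n) s v" "adjacent G v u"
      using dist[OF u(1)] unfolding n by (auto simp: relpowp_Suc_right)
    have "dist v \<le> n" unfolding dist_def using v(1) by (rule Least_le)
    \<comment> \<open>Since \<open>dist u \<le> N\<close>, the truncated subtraction is exact and
      the exponent really rises by at least one towards the sink.\<close>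
    then have "Suc (N - dist u) \<le> N - dist v" using N[OF u(1)] n by simp
    then have "B * h u \<le> h v"
      unfolding h_def power_Suc[symmetric] using \<open>B > 0\<close> by (intro power_increasing) auto
    moreover have "degree G u * h u < B * h u"
      using B[OF u(1)] \<open>B > 0\<close> by (simp add: h_def)
    ultimately have "degree G u * h u < h v" by (rule order.strict_trans2[rotated])
    also have "h v \<le> edge_count G u v * h v"
      using v(2) edge_count_pos_iff[of u v] adjacent_commute by simp
    also have "\<dots> \<le> (\<Sum>v \<in> verts G. edge_count G u v * h v)"
      using adjacent_verts[OF v(2)] finite_verts
      by (intro member_le_sum[of v "verts G" "\<lambda>v. edge_count G u v * h v"]) auto
    finally show ?thesis .
  qed
  ultimately show ?thesis by blast
qed

text \<open>A termination measure. For \<open>w v = h s - h v\<close>, strict subharmonicity of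
  \<open>h\<close> says that the grains sent out by a toppling weigh less than those lost at the
  toppled vertex.\<close>

lemma ex_potential:
  "\<exists>w :: 'v \<Rightarrow> nat. \<forall>c d. topples G s c d \<longrightarrow>
     (\<Sum>v \<in> nonsink G s. d v * w v) < (\<Sum>v \<in> nonsink G s. c v * w v)"
proof -
  obtain h :: "'v \<Rightarrow> nat" where h: "\<forall>v \<in> verts G. h v \<le> h s"
    "\<forall>u \<in> nonsink G s. degree G u * h u < (\<Sum>v \<in> verts G. edge_count G u v * h v)"
    using ex_subharmonic by blast
  define w where "w v = h s - h v" for v
  have "(\<Sum>v \<in> nonsink G s. d v * w v) < (\<Sum>v \<in> nonsink G s. c v * w v)"
    if t: "topples G s c d" for c d
  proof -
    obtain u where u: "u \<in> nonsink G s" "degree G u \<le> c u" "d = fire G s u c"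
      using t unfolding topples_iff_fire by blast
    have uv: "u \<in> verts G" using u(1) by (simp add: nonsink_def)
    \<comment> \<open>Because \<open>w v + h v = h s\<close> everywhere, both sides equal
      \<open>degree G u * h s\<close>, so the inequality for \<open>h\<close> reverses into one for
      \<open>w\<close>.\<close>
    have "(\<Sum>v \<in> verts G. edge_count G u v * w v) + (\<Sum>v \<in> verts G. edge_count G u v * h v)
        = (\<Sum>v \<in> verts G. edge_count G u v * h s)"
      unfolding sum.distrib[symmetric] w_def
      using h(1) by (intro sum.cong refl) (simp add: add_mult_distrib2[symmetric])
    also have "\<dots> = degree G u * w u + degree G u * h u"
      using h(1) uv degree_eq_sum[OF uv]
      by (simp add: sum_distrib_right[symmetric] add_mult_distrib2[symmetric] w_def)
    finally have "(\<Sum>v \<in> verts G. edge_count G u v * w v) < degree G u * w u"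
      using bspec[OF h(2) u(1)] by linarith
    \<comment> \<open>\<open>w\<close> vanishes at the sink, so dropping the sink leaves the sum
      unchanged.\<close>
    moreover have "(\<Sum>v \<in> nonsink G s. edge_count G u v * w v)
        = (\<Sum>v \<in> verts G. edge_count G u v * w v)"
      by (rule sum.mono_neutral_left) (use finite_verts in \<open>auto simp: nonsink_def w_def\<close>)
    ultimately have lt: "(\<Sum>v \<in> nonsink G s. edge_count G u v * w v) < degree G u * w u" by simp
    \<comment> \<open>The loss at \<open>u\<close> is added on the left to avoid subtraction; on the
      right the edge term at \<open>v = u\<close> is zero.\<close>
    have "(\<Sum>v \<in> nonsink G s. d v * w v) + degree G u * w u
        = (\<Sum>v \<in> nonsink G s. d v * w v + (if v = u then degree G u * w u else 0))"
      using u(1) finite_nonsink by (simp add: sum.distrib)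
    also have "\<dots> = (\<Sum>v \<in> nonsink G s. c v * w v + edge_count G u v * w v)"
      using u(2,3) by (intro sum.cong refl) (auto simp: fire_def add_mult_distrib[symmetric])
    finally show ?thesis using lt by (simp add: sum.distrib)
  qed
  then show ?thesis by blast
qed

text \<open>Induction on the potential: as long as some vertex is unstable, toppling it lowers the
  potential.\<close>

lemma ex_stabilization:
  assumes "c \<in> configs G s"
  shows "\<exists>d. (topples G s)\<^sup>*\<^sup>* c d \<and> stable_config G s d"
proof -
  obtain w :: "'v \<Rightarrow> nat" where w: "\<And>c d. topples G s c d \<Longrightarrow>
     (\<Sum>v \<in> nonsink G s. d v * w v) < (\<Sum>v \<in> nonsink G s. c v * w v)"
    using ex_potential by blast
  show ?thesis using assms
  proof (induction "\<Sum>v \<in> nonsink G s. c v * w v" arbitrary: c rule: less_induct)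
    case less
    show ?case
    proof (cases "stable_config G s c")
      case False
      then obtain u where "u \<in> nonsink G s" "degree G u \<le> c u"
        using less.prems by (auto simp: stable_config_def not_less)
      then have t: "topples G s c (fire G s u c)" by (rule topples_fire)
      show ?thesis
        using less.hyps[OF w[OF t] topples_configs[OF t less.prems]] t
        by (meson converse_rtranclp_into_rtranclp)
    qed auto
  qed
qed

section \<open>Stabilization and addition\<close>

lemma
  assumes "c \<in> configs G s"
  shows rtranclp_topples_stabilize: "(topples G s)\<^sup>*\<^sup>* c (stabilize G s c)"
    and stable_config_stabilize: "stable_config G s (stabilize G s c)"
  using ex_stabilization[OF assms] stabilize_eq by metis+

lemma stabilize_configs: "c \<in> configs G s \<Longrightarrow> stabilize G s c \<in> configs G s"
  by (rule stable_config_configs[OF stable_config_stabilize])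

lemma stabilize_reachable:
  assumes "(topples G s)\<^sup>*\<^sup>* c d" "c \<in> configs G s"
  shows "stabilize G s d = stabilize G s c"
proof -
  have d: "d \<in> configs G s" by (rule rtranclp_topples_configs[OF assms])
  show ?thesis
    by (rule stabilize_eq[symmetric,
        OF rtranclp_trans[OF assms(1) rtranclp_topples_stabilize[OF d]]
          stable_config_stabilize[OF d]])
qed

text \<open>Topplings of \<open>c\<close> stay legal in the presence of \<open>d\<close>, so
  stabilizing a summand early does not change the result. Associativity of the group operation rests
  on this.\<close>

lemma stabilize_config_add_stabilize:
  assumes "c \<in> configs G s" "d \<in> configs G s"
  shows "stabilize G s (config_add (stabilize G s c) d) = stabilize G s (config_add c d)"
  using assms by (intro stabilize_reachable rtranclp_topples_config_add_left
      rtranclp_topples_stabilize config_add_configs)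

lemma stabilize_config_add_stabilize_right:
  assumes "c \<in> configs G s" "d \<in> configs G s"
  shows "stabilize G s (config_add c (stabilize G s d)) = stabilize G s (config_add c d)"
  using stabilize_config_add_stabilize[OF assms(2,1)] by (simp add: config_add_commute)

end


section \<open>The sandpile group\<close>

lemma adjacent_induced:
  "adjacent (induced G U) x y \<longleftrightarrow> adjacent G x y \<and> x \<in> U \<and> y \<in> U"
  by (auto simp: adjacent_def induced_def)

context multigraph
begin

section \<open>Heights reached by multiples of a configuration\<close>

text \<open>Grains travel backwards along the path from \<open>w\<close> to \<open>v\<close>: for
  height \<open>m\<close> at \<open>v\<close>, build height \<open>m * degree G z\<close> at the
  next vertex \<open>z\<close> and topple \<open>z\<close> \<open>m\<close> times. The target height
  changes from step to step, hence \<open>m\<close> is arbitrary in the induction.\<close>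

lemma multiples_reach_any_height_at:
  assumes "(adjacent (induced G (nonsink G s)))\<^sup>*\<^sup>* v w" "w \<in> nonsink G s" "r w \<noteq> 0"
  shows "\<exists>n p. (topples G s)\<^sup>*\<^sup>* (\<lambda>x. n * r x) p \<and> m \<le> p v"
  using assms
proof (induction arbitrary: m rule: converse_rtranclp_induct)
  case base
  then have "m \<le> m * r w" by simp
  then show ?case by blast
next
  case (step v z)
  then have z: "z \<in> nonsink G s" "v \<in> nonsink G s" "edge_count G z v > 0"
    by (auto simp: adjacent_induced edge_count_pos_iff adjacent_commute)
  obtain n p where p: "(topples G s)\<^sup>*\<^sup>* (\<lambda>x. n * r x) p" "m * degree G z \<le> p z"
    using step.IH step.prems by blast
  obtain q where q: "(topples G s)\<^sup>*\<^sup>* p q"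
    "\<forall>w \<in> nonsink G s. w \<noteq> z \<longrightarrow> q w = p w + m * edge_count G z w"
    using topple_repeatedly[where c = p and m = m, OF z(1) p(2)] by blast
  have "v \<noteq> z" using z(3) by auto
  then have "q v = p v + m * edge_count G z v" using q(2) z(2) by blast
  moreover have "m \<le> m * edge_count G z v" using z(3) by simp
  ultimately have "m \<le> q v" by linarith
  moreover have "(topples G s)\<^sup>*\<^sup>* (\<lambda>x. n * r x) q" using p(1) q(1) by (rule rtranclp_trans)
  ultimately show ?case by blast
qed

text \<open>The heights are reached one vertex at a time and superposed: the multiples and the
  reached configurations both add up, so no height attained earlier drops.\<close>

lemma multiples_reach_any_height:
  assumes "\<forall>v \<in> nonsink G s. \<exists>w \<in> nonsink G s.
      (adjacent (induced G (nonsink G s)))\<^sup>*\<^sup>* v w \<and> r w \<noteq> 0"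
    and "k \<in> configs G s"
  shows "\<exists>n p. (topples G s)\<^sup>*\<^sup>* (\<lambda>x. n * r x) p \<and> k \<le> p"
proof -
  have "\<exists>n p. (topples G s)\<^sup>*\<^sup>* (\<lambda>x. n * r x) p \<and> (\<forall>v \<in> A. k v \<le> p v)"
    if "finite A" "A \<subseteq> nonsink G s" for A
    using that
  proof (induction A rule: finite_induct)
    case (insert a A)
    then obtain n p where p: "(topples G s)\<^sup>*\<^sup>* (\<lambda>x. n * r x) p" "\<forall>v \<in> A. k v \<le> p v" by auto
    have "a \<in> nonsink G s" using insert.prems by blast
    then obtain n' p' where p': "(topples G s)\<^sup>*\<^sup>* (\<lambda>x. n' * r x) p'" "k a \<le> p' a"
      using assms(1) multiples_reach_any_height_at by blast
    have "(topples G s)\<^sup>*\<^sup>* (\<lambda>x. (n + n') * r x) (config_add p p')"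
      using rtranclp_topples_config_add[OF p(1) p'(1)]
      by (simp add: config_add_def add_mult_distrib)
    moreover have "\<forall>v \<in> insert a A. k v \<le> config_add p p' v"
      using p(2) p'(2) by (auto simp: config_add_def intro: trans_le_add1 trans_le_add2)
    ultimately show ?case by blast
  qed auto
  then obtain n p where "(topples G s)\<^sup>*\<^sup>* (\<lambda>x. n * r x) p" "\<forall>v \<in> nonsink G s. k v \<le> p v"
    using finite_nonsink by blast
  moreover have "k v \<le> p v" if "v \<notin> nonsink G s" for v
    using that assms(2) by (simp add: configs_def)
  ultimately show ?thesis by (auto simp: le_fun_def)
qed

section \<open>Recurrence as reachability from every configuration\<close>

text \<open>\<open>c\<close> absorbs \<open>r\<close>, hence every multiple of \<open>r\<close>, and
  some multiple topples to a configuration \<open>p\<close> above \<open>k\<close>. So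
  \<open>c\<close> is the stabilization of \<open>config_add c p\<close>, which contains
  \<open>k\<close>.\<close>

lemma recurrent_reachable:
  assumes "recurrent G s c" "k \<in> configs G s"
  shows "\<exists>q \<in> configs G s. c = stabilize G s (config_add k q)"
proof -
  obtain r where r: "r \<in> configs G s" "stabilize G s (config_add c r) = c"
    "\<forall>v \<in> nonsink G s. \<exists>w \<in> nonsink G s.
      (adjacent (induced G (nonsink G s)))\<^sup>*\<^sup>* v w \<and> r w \<noteq> 0"
    using assms(1) unfolding recurrent_def by blast
  have c: "stable_config G s c" "c \<in> configs G s"
    using assms(1) by (auto simp: recurrent_def stable_config_def)
  have nr: "(\<lambda>x. n * r x) \<in> configs G s" for n
    using r(1) by (simp add: configs_def)
  obtain n p where p: "(topples G s)\<^sup>*\<^sup>* (\<lambda>x. n * r x) p" "k \<le> p"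
    using multiples_reach_any_height[OF r(3) assms(2)] by blast
  have "stabilize G s (config_add c (\<lambda>x. n * r x)) = c" for n
  proof (induction n)
    case 0
    then show ?case using stabilize_stable[OF c(1)] by (simp add: config_add_def)
  next
    case (Suc n)
    have "config_add c (\<lambda>x. Suc n * r x) = config_add (config_add c r) (\<lambda>x. n * r x)"
      by (simp add: config_add_def add.assoc)
    then show ?case
      using stabilize_config_add_stabilize[OF config_add_configs[OF c(2) r(1)] nr] Suc r(2) by simp
  qed
  then have "c = stabilize G s (config_add c p)"
    using stabilize_reachable[OF rtranclp_topples_config_add_left[OF p(1)]
        config_add_configs[OF nr c(2)]]
    by (simp add: config_add_commute)
  \<comment> \<open>The bound \<open>k \<le> p\<close> makes the truncated difference exact; the
    remainder is the witness \<open>q\<close>.\<close>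
  moreover have "config_add c p = config_add k (\<lambda>v. c v + (p v - k v))"
    using p(2) by (auto simp: config_add_def le_fun_def fun_eq_iff trans_le_add2)
  moreover have "(\<lambda>v. c v + (p v - k v)) \<in> configs G s"
    using c(2) rtranclp_topples_configs[OF p(1) nr] by (simp add: configs_def)
  ultimately show ?thesis by auto
qed

text \<open>Recurrent configurations form the minimal ideal of the monoid of stable configurations.\<close>

lemma recurrent_iff_reachable:
  "recurrent G s c \<longleftrightarrow> stable_config G s c \<and>
     (\<forall>k \<in> configs G s. \<exists>q \<in> configs G s. c = stabilize G s (config_add k q))"
    (is "?L \<longleftrightarrow> ?R")
proof
  assume R: ?R
  \<comment> \<open>One grain on every non-sink vertex makes \<open>config_add u q\<close> non-zero
    on every component, whatever \<open>q\<close> is; \<open>q\<close> comes from reaching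
    \<open>c\<close> from \<open>config_add c u\<close>.\<close>
  define u where "u v = (if v \<in> nonsink G s then 1 else 0 :: nat)" for v
  have u: "u \<in> configs G s" by (simp add: configs_def u_def)
  have c: "c \<in> configs G s" using R by (simp add: stable_config_def)
  obtain q where q: "q \<in> configs G s" "c = stabilize G s (config_add (config_add c u) q)"
    using R config_add_configs[OF c u] by blast
  have "\<forall>v \<in> nonsink G s. \<exists>w \<in> nonsink G s.
      (adjacent (induced G (nonsink G s)))\<^sup>*\<^sup>* v w \<and> config_add u q w \<noteq> 0"
    by (auto simp: config_add_def u_def)
  then show ?L
    using R q config_add_configs[OF u q(1)] unfolding recurrent_def
    by (metis config_add_assoc)
qed (use recurrent_reachable in \<open>auto simp: recurrent_def\<close>)

text \<open>The ideal property: a witness \<open>q\<close> for reaching \<open>c\<close> from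
  \<open>k\<close> becomes the witness \<open>config_add q d\<close>.\<close>

lemma recurrent_stabilize_config_add:
  assumes "recurrent G s c" "d \<in> configs G s"
  shows "recurrent G s (stabilize G s (config_add c d))"
proof -
  have c: "c \<in> configs G s" using assms(1) by (auto simp: recurrent_def stable_config_def)
  have "\<exists>q \<in> configs G s. stabilize G s (config_add c d) = stabilize G s (config_add k q)"
    if k: "k \<in> configs G s" for k
  proof -
    obtain q where q: "q \<in> configs G s" "c = stabilize G s (config_add k q)"
      using recurrent_reachable[OF assms(1) k] by blast
    then have "stabilize G s (config_add c d) = stabilize G s (config_add k (config_add q d))"
      using stabilize_config_add_stabilize[OF config_add_configs[OF k q(1)] assms(2)]
      by (simp add: config_add_assoc)
    then show ?thesis using config_add_configs[OF q(1) assms(2)] by blast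
  qed
  then show ?thesis
    using stable_config_stabilize config_add_configs[OF c assms(2)]
    unfolding recurrent_iff_reachable by blast
qed

text \<open>The maximal stable configuration is recurrent: every stabilization lies below it
  pointwise, so the difference can be added. Degrees are positive, so \<open>degree G v - 1\<close>
  is a genuine predecessor.\<close>

lemma ex_recurrent: "\<exists>c. recurrent G s c"
proof -
  define c where "c v = (if v \<in> nonsink G s then degree G v - 1 else 0)" for v
  have c: "stable_config G s c"
    using degree_pos by (auto simp: c_def stable_config_def configs_def)
  have "\<exists>q \<in> configs G s. c = stabilize G s (config_add k q)" if k: "k \<in> configs G s" for k
  proof
    let ?q = "\<lambda>v. c v - stabilize G s k v"
    show q: "?q \<in> configs G s" using c by (simp add: stable_config_def configs_def)
    have "stabilize G s k v \<le> c v" for v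
      using stable_config_stabilize[OF k] degree_pos
      by (fastforce simp: c_def stable_config_def configs_def)
    then have "config_add (stabilize G s k) ?q = c" by (simp add: config_add_def)
    then show "c = stabilize G s (config_add k ?q)"
      using stabilize_config_add_stabilize[OF k q] stabilize_stable[OF c] by simp
  qed
  then show ?thesis using c recurrent_iff_reachable by blast
qed

section \<open>The group axioms\<close>

text \<open>Reaching \<open>a\<close> from \<open>config_add a a\<close> with \<open>q\<close> shows
  that the stabilization of \<open>config_add a q\<close> fixes \<open>a\<close>. Any recurrent
  \<open>b\<close> is reached from \<open>a\<close> by adding some \<open>p\<close>, so it is fixed
  too.\<close>

lemma ex_recurrent_neutral:
  "\<exists>e. recurrent G s e \<and> (\<forall>c. recurrent G s c \<longrightarrow> stabilize G s (config_add e c) = c)"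
proof -
  obtain a where a: "recurrent G s a" using ex_recurrent by blast
  have ac: "a \<in> configs G s" using a by (auto simp: recurrent_def stable_config_def)
  obtain q where q: "q \<in> configs G s" "a = stabilize G s (config_add (config_add a a) q)"
    using recurrent_reachable[OF a config_add_configs[OF ac ac]] by blast
  let ?e = "stabilize G s (config_add a q)"
  have e: "recurrent G s ?e" using recurrent_stabilize_config_add[OF a q(1)] .
  have aq: "config_add a q \<in> configs G s" using config_add_configs[OF ac q(1)] .
  have ea: "stabilize G s (config_add ?e a) = a"
    using stabilize_config_add_stabilize[OF aq ac] q(2)
    by (simp add: config_add_assoc config_add_commute[of q a])
  have "stabilize G s (config_add ?e b) = b" if b: "recurrent G s b" for b
  proof -
    obtain p where p: "p \<in> configs G s" "b = stabilize G s (config_add a p)"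
      using recurrent_reachable[OF b ac] by blast
    have "stabilize G s (config_add ?e b) = stabilize G s (config_add (config_add ?e a) p)"
      using stabilize_config_add_stabilize_right[OF stabilize_configs[OF aq]
          config_add_configs[OF ac p(1)]] p(2)
      by (simp add: config_add_assoc)
    also have "\<dots> = stabilize G s (config_add a p)"
      using stabilize_config_add_stabilize[OF config_add_configs[OF stabilize_configs[OF aq] ac] p(1)]
        ea by simp
    finally show ?thesis using p(2) by simp
  qed
  then show ?thesis using e by blast
qed

lemma group_sandpile_group: "group (sandpile_group G s)"
proof -
  have conf: "c \<in> configs G s" if "recurrent G s c" for c
    using that by (auto simp: recurrent_def stable_config_def)
  obtain e where e: "recurrent G s e"
    "\<And>c. recurrent G s c \<Longrightarrow> stabilize G s (config_add e c) = c"
    using ex_recurrent_neutral by blast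
  \<comment> \<open>Two left neutral elements coincide because the operation is commutative.\<close>
  have one: "\<one>\<^bsub>sandpile_group G s\<^esub> = e"
    unfolding sandpile_group_def sandpile_on_def monoid.simps
  proof (rule the_equality)
    fix d assume "d \<in> {c. recurrent G s c} \<and>
      (\<forall>c \<in> {c. recurrent G s c}. stabilize G s (config_add d c) = c)"
    then show "d = e" using e by (metis config_add_commute mem_Collect_eq)
  qed (use e in auto)
  have inv: "\<exists>b. recurrent G s b \<and> stabilize G s (config_add b a) = e"
    if a: "recurrent G s a" for a
  proof -
    \<comment> \<open>\<open>q\<close> inverts \<open>a\<close> but may fail to be recurrent; adding
      \<open>e\<close> moves it into the ideal and keeps its effect on \<open>a\<close>.\<close>
    obtain q where q: "q \<in> configs G s" "e = stabilize G s (config_add a q)"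
      using recurrent_reachable[OF e(1) conf[OF a]] by blast
    have "stabilize G s (config_add (stabilize G s (config_add e q)) a)
        = stabilize G s (config_add (config_add e q) a)"
      using q(1) a e(1) conf by (intro stabilize_config_add_stabilize config_add_configs)
    also have "\<dots> = stabilize G s (config_add e (config_add a q))"
      by (simp add: config_add_assoc config_add_commute[of q a])
    also have "\<dots> = stabilize G s (config_add e e)"
      using stabilize_config_add_stabilize_right[of e "config_add a q"] q a e(1) conf
      by (simp add: config_add_configs)
    also have "\<dots> = e" using e by blast
    finally show ?thesis using recurrent_stabilize_config_add[OF e(1) q(1)] by blast
  qed
  show ?thesis
  proof (rule groupI)
    fix a b c
    assume "a \<in> carrier (sandpile_group G s)" "b \<in> carrier (sandpile_group G s)"
      "c \<in> carrier (sandpile_group G s)"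
    then have "a \<in> configs G s" "b \<in> configs G s" "c \<in> configs G s"
      using conf by (auto simp: sandpile_group_def sandpile_on_def)
    then show "a \<otimes>\<^bsub>sandpile_group G s\<^esub> b \<otimes>\<^bsub>sandpile_group G s\<^esub> c
        = a \<otimes>\<^bsub>sandpile_group G s\<^esub> (b \<otimes>\<^bsub>sandpile_group G s\<^esub> c)"
      by (simp add: sandpile_group_def sandpile_on_def stabilize_config_add_stabilize
          stabilize_config_add_stabilize_right config_add_configs config_add_assoc)
  qed (use e inv recurrent_stabilize_config_add conf in
      \<open>auto simp: one, auto simp: sandpile_group_def sandpile_on_def\<close>)
qed

end


section \<open>Weighted quotients of multigraphs\<close>

text \<open>Both \<open>x \<in> V\<close> (weight 1) and \<open>x \<notin> V\<close> (weight \<open>deg f\<close>) satisfy the same counting identity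
  \<open>fiber_sum\<close>; everything else about the homomorphism follows from it.\<close>

locale weighted_quotient = H: multigraph H t + G: multigraph G s
  for H :: "('w, 'd) mgraph" and t :: 'w and G :: "('v, 'e) mgraph" and s :: 'v +
  fixes f :: "'v \<Rightarrow> 'w" and k :: "'w \<Rightarrow> nat"
  assumes image_verts: "f ` verts G = verts H"
    and fiber_sink: "fiber G f t = {s}"
    and weight_pos: "x \<in> nonsink H t \<Longrightarrow> k x > 0"
    and fiber_sum: "\<lbrakk>v \<in> verts G; x \<in> verts H\<rbrakk> \<Longrightarrow>
      (\<Sum>u \<in> fiber G f x. edge_count G v u) = k (f v) * edge_count H (f v) x"
begin

text \<open>With \<open>k\<close> equal to 1 on \<open>V\<close> and to the degree of
  \<open>f\<close> elsewhere, this is \<open>induced_map\<close>.\<close>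

definition lift :: "('w \<Rightarrow> nat) \<Rightarrow> 'v \<Rightarrow> nat" where
  "lift c = (\<lambda>v. if v \<in> nonsink G s then k (f v) * c (f v) else 0)"

lemma finite_fiber: "finite (fiber G f x)"
  using G.finite_verts by (simp add: fiber_def)

lemma sink_iff: "v \<in> verts G \<Longrightarrow> f v = t \<longleftrightarrow> v = s"
  using fiber_sink by (fastforce simp: fiber_def)

lemma nonsink_iff: "v \<in> nonsink G s \<longleftrightarrow> v \<in> verts G \<and> f v \<in> nonsink H t"
  using sink_iff image_verts by (auto simp: nonsink_def)

lemma ex_fiber: "x \<in> verts H \<Longrightarrow> \<exists>v \<in> verts G. f v = x"
  unfolding image_verts[symmetric] by blast

text \<open>Group the neighbours of \<open>v\<close> by fibre and apply \<open>fiber_sum\<close> in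
  each. The stability threshold thus scales by the same factor as \<open>lift\<close>.\<close>

lemma degree_weighted:
  assumes "v \<in> verts G"
  shows "degree G v = k (f v) * degree H (f v)"
proof -
  have "f v \<in> verts H" using assms image_verts by blast
  have "degree G v = (\<Sum>u \<in> verts G. edge_count G v u)"
    by (rule G.degree_eq_sum[OF assms])
  also have "\<dots> = (\<Sum>x \<in> verts H. \<Sum>u \<in> {u \<in> verts G. f u = x}. edge_count G v u)"
    by (rule sum.group[symmetric]) (use G.finite_verts H.finite_verts image_verts in auto)
  also have "\<dots> = (\<Sum>x \<in> verts H. k (f v) * edge_count H (f v) x)"
    using fiber_sum[OF assms] by (simp add: fiber_def)
  also have "\<dots> = k (f v) * degree H (f v)"
    using H.degree_eq_sum[OF \<open>f v \<in> verts H\<close>] by (simp add: sum_distrib_left)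
  finally show ?thesis .
qed

section \<open>Lifting configurations and topplings\<close>

lemma lift_configs: "lift c \<in> configs G s"
  by (simp add: lift_def configs_def)

lemma lift_config_add: "lift (config_add c d) = config_add (lift c) (lift d)"
  by (auto simp: lift_def config_add_def add_mult_distrib2)

text \<open>Fibres are non-empty and weights positive, so \<open>c x\<close> can be read off at any
  vertex over \<open>x\<close>.\<close>

lemma inj_on_lift: "inj_on lift (configs H t)"
proof (rule inj_onI, rule ext)
  fix c d x assume cd: "c \<in> configs H t" "d \<in> configs H t" "lift c = lift d"
  show "c x = d x"
  proof (cases "x \<in> nonsink H t")
    case True
    then obtain v where v: "v \<in> verts G" "f v = x" using ex_fiber by (auto simp: nonsink_def)
    then show ?thesis
      using fun_cong[OF cd(3), of v] True weight_pos[OF True] nonsink_iff by (simp add: lift_def)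
  qed (use cd in \<open>simp add: configs_def\<close>)
qed

lemma lift_stable_config:
  assumes "stable_config H t c"
  shows "stable_config G s (lift c)"
  using assms lift_configs weight_pos degree_weighted nonsink_iff
  by (auto simp: stable_config_def lift_def)

text \<open>Topple the whole fibre over \<open>x\<close> once. By \<open>fiber_sum\<close> a vertex
  \<open>v\<close> outside it gains \<open>k (f v) * edge_count H x (f v)\<close>, which is the
  lifted gain of \<open>f v\<close>.\<close>

lemma rtranclp_topples_lift_fire:
  assumes x: "x \<in> nonsink H t" and deg: "degree H x \<le> c x"
  shows "(topples G s)\<^sup>*\<^sup>* (lift c) (lift (fire H t x c))"
proof -
  let ?A = "fiber G f x"
  have sub: "?A \<subseteq> nonsink G s" using x nonsink_iff by (auto simp: fiber_def)
  have xv: "x \<in> verts H" using x by (simp add: nonsink_def)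
  \<comment> \<open>\<open>H\<close> has no loop at \<open>x\<close>, so \<open>fiber_sum\<close>
    gives zero edges inside the fibre.\<close>
  have indep: "\<forall>u \<in> ?A. \<forall>v \<in> ?A. edge_count G u v = 0"
  proof
    fix u assume "u \<in> ?A"
    then have "(\<Sum>v \<in> ?A. edge_count G u v) = 0"
      using fiber_sum[of u x] xv by (simp add: fiber_def)
    then show "\<forall>v \<in> ?A. edge_count G u v = 0" using finite_fiber by simp
  qed
  have deg_lift: "\<forall>u \<in> ?A. degree G u \<le> lift c u"
    using sub deg degree_weighted by (auto simp: lift_def fiber_def)
  have "(\<lambda>v. if v \<in> ?A then lift c v - degree G v
      else if v \<in> nonsink G s then lift c v + (\<Sum>u \<in> ?A. edge_count G u v) else lift c v)
    = lift (fire H t x c)" (is "?d = _")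
  proof
    fix v
    show "?d v = lift (fire H t x c) v"
    proof (cases "v \<in> nonsink G s")
      case True
      then have v: "v \<in> verts G" "f v \<in> nonsink H t" using nonsink_iff by auto
      have "v \<in> ?A \<longleftrightarrow> f v = x" using v(1) by (simp add: fiber_def)
      moreover have "(\<Sum>u \<in> ?A. edge_count G u v) = k (f v) * edge_count H x (f v)"
        using fiber_sum[OF v(1) xv] by (simp add: edge_count_commute)
      ultimately show ?thesis
        using True v by (simp add: lift_def fire_def degree_weighted diff_mult_distrib2
            add_mult_distrib2)
    qed (use sub in \<open>auto simp: lift_def\<close>)
  qed
  then show ?thesis using topple_independent_set[OF finite_fiber sub indep deg_lift] by simp
qed

lemma rtranclp_topples_lift:
  "(topples H t)\<^sup>*\<^sup>* c d \<Longrightarrow> (topples G s)\<^sup>*\<^sup>* (lift c) (lift d)"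
proof (induction rule: rtranclp_induct)
  case (step d e)
  then show ?case
    using rtranclp_topples_lift_fire by (metis rtranclp_trans topples_iff_fire)
qed simp

text \<open>The lifted toppling sequence ends in a stable configuration, which uniqueness
  identifies.\<close>

lemma stabilize_lift:
  assumes "c \<in> configs H t"
  shows "stabilize G s (lift c) = lift (stabilize H t c)"
  by (intro stabilize_eq rtranclp_topples_lift lift_stable_config
      H.rtranclp_topples_stabilize H.stable_config_stabilize assms)

lemma lift_stabilize_config_add:
  assumes "c \<in> configs H t" "d \<in> configs H t"
  shows "lift (stabilize H t (config_add c d)) = stabilize G s (config_add (lift c) (lift d))"
  using stabilize_lift[OF config_add_configs[OF assms]] by (simp add: lift_config_add)

section \<open>Lifting recurrence\<close>

text \<open>An edge from \<open>y\<close> to \<open>z\<close> makes \<open>fiber_sum\<close>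
  positive at every vertex over \<open>y\<close>, so each such vertex has a neighbour over
  \<open>z\<close>.\<close>

lemma lift_path:
  assumes "(adjacent (induced H (nonsink H t)))\<^sup>*\<^sup>* x y" "v \<in> verts G" "f v = x"
  shows "\<exists>w \<in> verts G. f w = y \<and> (adjacent (induced G (nonsink G s)))\<^sup>*\<^sup>* v w"
  using assms
proof (induction rule: rtranclp_induct)
  case (step y z)
  then obtain w where w: "w \<in> verts G" "f w = y" "(adjacent (induced G (nonsink G s)))\<^sup>*\<^sup>* v w"
    by blast
  have yz: "adjacent H y z" "y \<in> nonsink H t" "z \<in> nonsink H t"
    using step.hyps(2) by (auto simp: adjacent_induced)
  have "(\<Sum>u \<in> fiber G f z. edge_count G w u) = k y * edge_count H y z"
    using fiber_sum[OF w(1), of z] w(2) yz(3) by (simp add: nonsink_def)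
  then have "(\<Sum>u \<in> fiber G f z. edge_count G w u) \<noteq> 0"
    using weight_pos[OF yz(2)] yz(1) H.edge_count_pos_iff[of y z] by simp
  then obtain u where u: "u \<in> fiber G f z" "edge_count G w u \<noteq> 0"
    by (meson sum.neutral)
  then have "adjacent (induced G (nonsink G s)) w u"
    using G.edge_count_pos_iff[of w u] w yz nonsink_iff
    by (auto simp: adjacent_induced fiber_def)
  then show ?case using u(1) w(3) by (auto simp: fiber_def intro: rtranclp.rtrancl_into_rtrancl)
qed blast

lemma lift_nonzero_iff:
  "w \<in> verts G \<Longrightarrow> f w \<in> nonsink H t \<Longrightarrow> lift r w \<noteq> 0 \<longleftrightarrow> r (f w) \<noteq> 0"
  using weight_pos nonsink_iff by (auto simp: lift_def)

lemma lift_recurrent_short: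
  assumes "recurrent_short H t c"
  shows "recurrent_short G s (lift c)"
proof -
  obtain r where c: "stable_config H t c" and r: "r \<in> configs H t" "r \<noteq> (\<lambda>_. 0)"
    "stabilize H t (config_add c r) = c"
    using assms unfolding recurrent_short_def by blast
  have "stabilize G s (config_add (lift c) (lift r)) = lift c"
    using lift_stabilize_config_add[OF stable_config_configs[OF c] r(1)] r(3) by simp
  moreover have "lift r \<noteq> (\<lambda>_. 0)"
  proof
    assume "lift r = (\<lambda>_. 0)"
    then have "lift r = lift (\<lambda>_. 0)" by (auto simp: lift_def fun_eq_iff)
    then show False using inj_onD[OF inj_on_lift _ r(1)] r(2) by (simp add: configs_def)
  qed
  ultimately show ?thesis
    using lift_stable_config[OF c] lift_configs unfolding recurrent_short_def by blast
qed

text \<open>\<open>lift r\<close> is the witness. It meets every component because a path from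
  \<open>f v\<close> to a vertex where \<open>r\<close> is non-zero lifts to a path starting at
  \<open>v\<close>.\<close>

lemma lift_recurrent:
  assumes "recurrent H t c"
  shows "recurrent G s (lift c)"
proof -
  obtain r where c: "stable_config H t c" and r: "r \<in> configs H t"
    "stabilize H t (config_add c r) = c"
    "\<forall>x \<in> nonsink H t. \<exists>y \<in> nonsink H t.
      (adjacent (induced H (nonsink H t)))\<^sup>*\<^sup>* x y \<and> r y \<noteq> 0"
    using assms unfolding recurrent_def by blast
  have "\<exists>w \<in> nonsink G s. (adjacent (induced G (nonsink G s)))\<^sup>*\<^sup>* v w \<and> lift r w \<noteq> 0"
    if "v \<in> nonsink G s" for v
  proof -
    have v: "v \<in> verts G" "f v \<in> nonsink H t" using that nonsink_iff by auto
    then obtain y where y: "y \<in> nonsink H t" "r y \<noteq> 0"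
      "(adjacent (induced H (nonsink H t)))\<^sup>*\<^sup>* (f v) y"
      using r(3) by blast
    obtain w where w: "w \<in> verts G" "f w = y" "(adjacent (induced G (nonsink G s)))\<^sup>*\<^sup>* v w"
      using lift_path[OF y(3) v(1)] by blast
    then have "w \<in> nonsink G s" "lift r w \<noteq> 0"
      using y nonsink_iff lift_nonzero_iff by auto
    then show ?thesis using w(3) by blast
  qed
  moreover have "stabilize G s (config_add (lift c) (lift r)) = lift c"
    using lift_stabilize_config_add[OF stable_config_configs[OF c] r(1)] r(2) by simp
  ultimately show ?thesis
    using lift_stable_config[OF c] lift_configs unfolding recurrent_def by blast
qed

section \<open>The lift as an injective homomorphism\<close>

text \<open>Arbitrary carriers are allowed so that both forms of recurrence are covered.\<close>

lemma lift_hom_sandpile_on: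
  assumes "R \<subseteq> configs H t" "lift ` R \<subseteq> R'"
  shows "lift \<in> hom (sandpile_on R H t) (sandpile_on R' G s)"
  using assms by (auto simp: hom_def sandpile_on_def intro!: lift_stabilize_config_add)

lemma recurrent_subset: "{c. recurrent H t c} \<subseteq> configs H t"
  by (auto simp: recurrent_def stable_config_def)

lemma recurrent_short_subset: "{c. recurrent_short H t c} \<subseteq> configs H t"
  by (auto simp: recurrent_short_def stable_config_def)

lemma group_hom_lift: "group_hom (sandpile_group H t) (sandpile_group G s) lift"
  unfolding group_hom_def group_hom_axioms_def
  using H.group_sandpile_group G.group_sandpile_group lift_recurrent
  unfolding sandpile_group_def by (auto intro!: lift_hom_sandpile_on recurrent_subset)

text \<open>Stated with \<open>hom\<close>, which asks for closure and multiplicativity only, since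
  \<open>sandpile_short\<close> need not be a group.\<close>

lemma lift_hom_sandpile_short: "lift \<in> hom (sandpile_short H t) (sandpile_short G s)"
  unfolding sandpile_short_def
  using lift_recurrent_short by (intro lift_hom_sandpile_on recurrent_short_subset) auto

lemma inj_on_lift_sandpile_group: "inj_on lift (carrier (sandpile_group H t))"
  using inj_on_subset[OF inj_on_lift recurrent_subset]
  by (simp add: sandpile_group_def sandpile_on_def)

lemma inj_on_lift_sandpile_short: "inj_on lift (carrier (sandpile_short H t))"
  using inj_on_subset[OF inj_on_lift recurrent_short_subset]
  by (simp add: sandpile_short_def sandpile_on_def)

end


section \<open>Uniform homomorphisms as weighted quotients\<close>

text \<open>For \<open>f v\<close> in \<open>V\<close>, \<open>fiber_sum\<close> is uniformity. For
  \<open>f v\<close> outside \<open>V\<close>, the fibre of \<open>f v\<close> is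
  \<open>{v}\<close>: if \<open>x\<close> is in \<open>V\<close>, the edges are counted from the
  fibre over \<open>x\<close>, which has \<open>hom_degree G V f\<close> vertices; otherwise both
  sides vanish by stability of the complement of \<open>V\<close>.\<close>

lemma uniform_hom_weighted_quotient:
  assumes G: "multigraph G s" and H: "multigraph H t"
    and V: "V \<subseteq> verts H" and stable: "stable_set H (verts H - V)"
    and hom: "uniform_hom G H V f" and surj: "f ` verts G = verts H"
    and sink: "fiber G f t = {s}" and deg: "degree_well_defined G V f"
  shows "weighted_quotient H t G s f (\<lambda>x. if x \<in> V then 1 else hom_degree G V f)"
proof -
  interpret G: multigraph G s by fact
  interpret H: multigraph H t by fact
  have fin: "finite (fiber G f x)" for x using G.finite_verts by (simp add: fiber_def)
  \<comment> \<open>\<open>degree_well_defined\<close> makes the choice inside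
    \<open>hom_degree\<close> immaterial.\<close>
  have card: "card (fiber G f x) = hom_degree G V f" if "x \<in> V" for x
    using deg that someI[of "\<lambda>x. x \<in> V" x]
    unfolding degree_well_defined_def hom_degree_def by blast
  have unif: "(\<Sum>u \<in> fiber G f y. edge_count G v u) = edge_count H (f v) y"
    if "v \<in> verts G" "f v \<in> V" "y \<in> verts H" for v y
  proof -
    have "v \<in> fiber G f (f v)" using that(1) by (simp add: fiber_def)
    then have "degree (induced G ({v} \<union> fiber G f y)) v = edge_count H (f v) y"
      using hom that unfolding uniform_hom_def by blast
    then show ?thesis using G.degree_induced[OF fin] by simp
  qed
  have nonadj: "edge_count H x y = 0" if "x \<in> verts H - V" "y \<in> verts H - V" for x y
    using stable that H.edge_count_eq_0 by (simp add: stable_set_def)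
  have outside: "edge_count G v u = 0"
    if "v \<in> verts G" "u \<in> verts G" "f v \<notin> V" "f u \<notin> V" for v u
  proof -
    have "edge_count G v u = edge_count H (f v) (f u)"
      using hom that unfolding uniform_hom_def by blast
    moreover have "f v \<in> verts H - V" "f u \<in> verts H - V" using that surj by blast+
    ultimately show ?thesis using nonadj by simp
  qed
  have singleton: "fiber G f (f v) = {v}" if "v \<in> verts G" "f v \<notin> V" for v
  proof -
    have "inj_on f {u \<in> verts G. f u \<notin> V}"
      using hom by (simp add: uniform_hom_def bij_betw_def)
    then show ?thesis using that by (auto simp: fiber_def dest: inj_onD)
  qed
  show ?thesis
  proof
    show "f ` verts G = verts H" "fiber G f t = {s}" by fact+
  next
    fix x assume x: "x \<in> nonsink H t"
    then have xv: "x \<in> verts H" by (simp add: nonsink_def)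
    obtain y where y: "adjacent H x y" using H.nonsink_adjacent[OF x] by blast
    \<comment> \<open>An edge cannot have both ends in the stable complement, so \<open>V\<close> is
      non-empty; surjectivity then makes the degree of \<open>f\<close> positive.\<close>
    then have "x \<in> V \<or> y \<in> V"
      using stable H.adjacent_verts unfolding stable_set_def by blast
    then obtain z where z: "z \<in> V" by blast
    then have "z \<in> f ` verts G" using V surj by blast
    then have "fiber G f z \<noteq> {}" by (auto simp: fiber_def)
    then have "hom_degree G V f > 0" using card[OF z] fin by (metis card_gt_0_iff)
    then show "(if x \<in> V then 1 else hom_degree G V f) > 0" by simp
  next
    fix v x assume v: "v \<in> verts G" and x: "x \<in> verts H"
    show "(\<Sum>u \<in> fiber G f x. edge_count G v u)
        = (if f v \<in> V then 1 else hom_degree G V f) * edge_count H (f v) x"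
    proof (cases "f v \<in> V")
      case True
      then show ?thesis using unif v x by simp
    next
      case notV: False
      have fv: "f v \<in> verts H" using v surj by blast
      show ?thesis
      proof (cases "x \<in> V")
        case True
        have "edge_count G v u = edge_count H (f v) x" if "u \<in> fiber G f x" for u
        proof -
          have u: "u \<in> verts G" "f u = x" using that by (auto simp: fiber_def)
          \<comment> \<open>Uniformity at \<open>u\<close> towards the one-element fibre of
            \<open>f v\<close>: its sum has the single term for \<open>v\<close>.\<close>
          then have "edge_count G u v = edge_count H x (f v)"
            using unif[of u "f v"] True fv singleton[OF v notV] by simp
          then show ?thesis by (simp add: edge_count_commute)
        qed
        then show ?thesis using card[OF True] notV by simp
      next
        case False
        then show ?thesis using outside[OF v] nonadj notV fv x by (simp add: fiber_def)
      qed
    qed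
  qed
qed

theorem theorem3p5:
  fixes G :: "('v, 'e) mgraph" and s\<^sub>G :: 'v
    and H :: "('w, 'd) mgraph" and s\<^sub>H :: 'w
    and V :: "'w set" and f :: "'v \<Rightarrow> 'w"
  assumes "multigraph G s\<^sub>G"
    and "multigraph H s\<^sub>H"
    and "V \<subseteq> verts H"
    and "stable_set H (verts H - V)"
    and "s\<^sub>H \<notin> V"
    and "uniform_hom G H V f"
    and "f ` verts G = verts H"
    and "fiber G f s\<^sub>H = {s\<^sub>G}"
    and "degree_well_defined G V f"
  shows "group_hom (sandpile_group H s\<^sub>H) (sandpile_group G s\<^sub>G) (induced_map G s\<^sub>G V f)
    \<and> inj_on (induced_map G s\<^sub>G V f) (carrier (sandpile_group H s\<^sub>H))
    \<and> subgroup (induced_map G s\<^sub>G V f ` carrier (sandpile_group H s\<^sub>H)) (sandpile_group G s\<^sub>G)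
    \<and> induced_map G s\<^sub>G V f \<in> hom (sandpile_short H s\<^sub>H) (sandpile_short G s\<^sub>G)
    \<and> inj_on (induced_map G s\<^sub>G V f) (carrier (sandpile_short H s\<^sub>H))"
proof -
  interpret weighted_quotient H s\<^sub>H G s\<^sub>G f "\<lambda>x. if x \<in> V then 1 else hom_degree G V f"
    using assms(1-4,6-9) by (rule uniform_hom_weighted_quotient)
  have "induced_map G s\<^sub>G V f = lift"
    by (auto simp: induced_map_def lift_def fun_eq_iff)
  then show ?thesis
    using group_hom_lift inj_on_lift_sandpile_group group_hom.img_is_subgroup[OF group_hom_lift]
      lift_hom_sandpile_short inj_on_lift_sandpile_short by simp
qed

end
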